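(* Let $\mathbb{K}$ be a field, $c\in\mathbb{N}$ and $R=\mathbb{K}[x_{i,j}\mid 1\le i\le c,\ j\in\mathbb{N}]$. For every $\mathrm{Inc}(\mathbb{N})$-invariant ideal chain $J_\circ$ in $R$, the set of initial ideal chains $$\{\mathrm{in}_\preceq(J_\circ)\mid\ \preceq\text{ is an }\mathrm{Inc}(\mathbb{N})\text{-compatible term order on }R\}$$ is finite.
   Context: $\mathbb{N}=\{1,2,3,\dots\}$ and $[n]=\{1,\dots,n\}$. $R_n=\mathbb{K}[x_{i,j}\mid i\in[c],j\in[n]]\subseteq R$. $\mathrm{Inc}(\mathbb{N})$ is the monoid of strictly increasing functions $p:\mathbb{N}\to\mathbb{N}$; it acts on $R$ by $\mathbb{K}$-linear extension of $p\cdot(x_{i_1,j_1}^{e_1}\cdots x_{i_r,j_r}^{e_r})=x_{i_1,p(j_1)}^{e_1}\cdots x_{i_r,p(j_r)}^{e_r}$. For $m\le n$, $\mathrm{Inc}(\mathbb{N})_{m,n}=\{p\in\mathrm{Inc}(\mathbb{N})\mid p(m)\le n\}$. An $\mathrm{Inc}(\mathbb{N})$-invariant ideal chain in $R$ is a sequence $J_\circ=J_1\subseteq J_2\subseteq\dots$ with each $J_n$ an ideal of $R_n$ and $p\cdot f\in J_n$ for all $m\le n$, $p\in\mathrm{Inc}(\mathbb{N})_{m,n}$, $f\in J_m$. A term order $\preceq$ on $R$ is a total order on the monomials of $R$ that respects multiplication and satisfies $1\preceq f$ for every monomial $f$. It is $\mathrm{Inc}(\mathbb{N})$-compatible if $f\preceq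 g$ implies $p\cdot f\preceq p\cdot g$ for all monomials $f,g\in R$ and all $p\in\mathrm{Inc}(\mathbb{N})$. $\mathrm{in}_\preceq(f)$ denotes the leading (i.e. $\preceq$-largest) monomial of a nonzero polynomial $f$, and $\mathrm{in}_\preceq(J_n)$ is the ideal of $R_n$ generated by the leading monomials of the nonzero elements of $J_n$. $\mathrm{in}_\preceq(J_\circ)$ denotes the sequence $\mathrm{in}_\preceq(J_1)\subseteq\mathrm{in}_\preceq(J_2)\subseteq\dots$; two chains are equal if they agree at every $n$. *)

theory Defs
  imports "HOL-Library.Poly_Mapping" "HOL-Algebra.Ideal"
begin

text \<open>
  The variable \<open>x\<^bsub>i,j\<^esub>\<close> is the pair \<open>(i, j)\<close>, with both indices starting at 1. A monomial is
  its exponent vector, so that the product of monomials is addition of exponent vectors and the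
  monomial 1 is the exponent vector 0. The type \<open>'k mpoly\<close> also contains polynomials
  involving indices outside the intended range; the sets below impose \<open>1 \<le> i \<le> c\<close> and \<open>j \<ge> 1\<close>.
\<close>

type_synonym mon = "(nat \<times> nat) \<Rightarrow>\<^sub>0 nat"
type_synonym 'k mpoly = "mon \<Rightarrow>\<^sub>0 'k"

definition monomials :: "nat \<Rightarrow> mon set" where
  "monomials c = {t. Poly_Mapping.keys t \<subseteq> {1..c} \<times> {1..}}"

definition monomials_upto :: "nat \<Rightarrow> nat \<Rightarrow> mon set" where
  "monomials_upto c n = {t. Poly_Mapping.keys t \<subseteq> {1..c} \<times> {1..n}}"

definition poly_ring_upto :: "nat \<Rightarrow> nat \<Rightarrow> ('k::field mpoly) ring" where
  "poly_ring_upto c n =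
    \<lparr>carrier = {f. Poly_Mapping.keys f \<subseteq> monomials_upto c n},
     mult = (*), one = 1, zero = 0, add = (+)\<rparr>"

definition Inc :: "(nat \<Rightarrow> nat) set" where
  "Inc = {p. p \<in> {1..} \<rightarrow> {1..} \<and> strict_mono_on {1..} p}"

definition Inc_between :: "nat \<Rightarrow> nat \<Rightarrow> (nat \<Rightarrow> nat) set" where
  "Inc_between m n = {p \<in> Inc. p m \<le> n}"

definition mon_act :: "(nat \<Rightarrow> nat) \<Rightarrow> mon \<Rightarrow> mon" where
  "mon_act p t = (\<Sum>(i, j)\<in>Poly_Mapping.keys t.
     Poly_Mapping.single (i, p j) (Poly_Mapping.lookup t (i, j)))"

definition poly_act :: "(nat \<Rightarrow> nat) \<Rightarrow> 'k::field mpoly \<Rightarrow> 'k mpoly" where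
  "poly_act p f = (\<Sum>t\<in>Poly_Mapping.keys f.
     Poly_Mapping.single (mon_act p t) (Poly_Mapping.lookup f t))"

text \<open>Chains are indexed by \<open>n \<ge> 1\<close>; the value of \<open>J\<close> at 0 is irrelevant.\<close>

definition Inc_invariant_chain :: "nat \<Rightarrow> (nat \<Rightarrow> 'k::field mpoly set) \<Rightarrow> bool" where
  "Inc_invariant_chain c J \<longleftrightarrow>
     (\<forall>n\<ge>1. ideal (J n) (poly_ring_upto c n)) \<and>
     (\<forall>n\<ge>1. J n \<subseteq> J (Suc n)) \<and>
     (\<forall>m\<ge>1. \<forall>n\<ge>m. \<forall>p\<in>Inc_between m n. \<forall>f\<in>J m. poly_act p f \<in> J n)"

text \<open>\<open>(s, t) \<in> r\<close> stands for \<open>s \<preceq> t\<close>.\<close>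

definition term_order :: "nat \<Rightarrow> mon rel \<Rightarrow> bool" where
  "term_order c r \<longleftrightarrow>
     linear_order_on (monomials c) r \<and>
     (\<forall>s t. \<forall>u\<in>monomials c. (s, t) \<in> r \<longrightarrow> (s + u, t + u) \<in> r) \<and>
     (\<forall>t\<in>monomials c. (0, t) \<in> r)"

definition Inc_compatible :: "mon rel \<Rightarrow> bool" where
  "Inc_compatible r \<longleftrightarrow>
     (\<forall>s t. \<forall>p\<in>Inc. (s, t) \<in> r \<longrightarrow> (mon_act p s, mon_act p t) \<in> r)"

definition leading_mon :: "mon rel \<Rightarrow> 'k::field mpoly \<Rightarrow> mon" where
  "leading_mon r f =
     (THE t. t \<in> Poly_Mapping.keys f \<and> (\<forall>s\<in>Poly_Mapping.keys f. (s, t) \<in> r))"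

definition initial_ideal ::
    "nat \<Rightarrow> nat \<Rightarrow> mon rel \<Rightarrow> 'k::field mpoly set \<Rightarrow> 'k mpoly set" where
  "initial_ideal c n r I =
     Idl\<^bsub>poly_ring_upto c n\<^esub> {Poly_Mapping.single (leading_mon r f) 1 | f. f \<in> I \<and> f \<noteq> 0}"

text \<open>The restriction to \<open>n \<ge> 1\<close> makes equality of functions the same as equality of chains.\<close>

definition initial_chain ::
    "nat \<Rightarrow> mon rel \<Rightarrow> (nat \<Rightarrow> 'k::field mpoly set) \<Rightarrow> nat \<Rightarrow> 'k mpoly set" where
  "initial_chain c r J = (\<lambda>n\<in>{1..}. initial_ideal c n r (J n))"

lemma monomials_upto_add:
  "s \<in> monomials_upto c n \<Longrightarrow> t \<in> monomials_upto c n \<Longrightarrow> s + t \<in> monomials_upto c n"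
  unfolding monomials_upto_def using keys_add [of s t] by blast

lemma cring_poly_ring_upto: "cring (poly_ring_upto c n :: ('k::field mpoly) ring)"
proof (rule cringI)
  let ?R = "poly_ring_upto c n :: ('k mpoly) ring"
  show "abelian_group ?R"
  proof (rule abelian_groupI)
    fix f assume "f \<in> carrier ?R"
    then show "\<exists>g\<in>carrier ?R. g \<oplus>\<^bsub>?R\<^esub> f = \<zero>\<^bsub>?R\<^esub>"
      by (intro bexI [of _ "- f"]) (auto simp: poly_ring_upto_def in_keys_iff)
  qed (use keys_add in \<open>fastforce simp: poly_ring_upto_def add.assoc add.commute\<close>)+
  show "comm_monoid ?R"
  proof (rule comm_monoidI)
    fix f g assume fg: "f \<in> carrier ?R" "g \<in> carrier ?R"
    show "f \<otimes>\<^bsub>?R\<^esub> g \<in> carrier ?R"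
      using fg keys_mult [of f g] monomials_upto_add
      by (fastforce simp: poly_ring_upto_def)
  qed (auto simp: poly_ring_upto_def monomials_upto_def mult.assoc mult.commute)
qed (auto simp: poly_ring_upto_def distrib_right)

lemma leading_mon_eqI:
  assumes "term_order c r" "t \<in> Poly_Mapping.keys f" "\<And>s. s \<in> Poly_Mapping.keys f \<Longrightarrow> (s, t) \<in> r"
  shows "leading_mon r f = t"
  unfolding leading_mon_def
proof (rule the_equality)
  fix u assume "u \<in> Poly_Mapping.keys f \<and> (\<forall>s\<in>Poly_Mapping.keys f. (s, u) \<in> r)"
  with assms show "u = t"
    by (auto simp: term_order_def linear_order_on_def partial_order_on_def dest: antisymD)
qed (use assms in auto)

end

theory Submission
  imports Complex_Main Defs "HOL-Library.Sublist"
begin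

text \<open>
  Record an order by its set of pairs \<open>(n, in f)\<close> with \<open>0 \<noteq> f \<in> J\<^sub>n\<close>. These sets are upward
  closed under Inc-divisibility, which is a well-quasi-order by Higman's lemma applied to the words
  of columns of exponents. If \<open>(n, t)\<close> lies in such a set \<open>L\<close>, some \<open>f \<in> J\<^sub>n\<close> has \<open>t\<close>
  as its only monomial in \<open>L\<close>, whereas every order picks some monomial of \<open>f\<close>. Were there
  infinitely many sets \<open>L\<close>, then a finite set \<open>A\<close> contained in infinitely many of them could be
  enlarged, by the pigeonhole principle, by a monomial that no element of \<open>A\<close> divides; repeating
  this contradicts the well-quasi-order.
\<close>

section \<open>Well-quasi-orders\<close>

text \<open>A decreasing sequence of naturals is constant once it has reached its minimum, so its
  tail is nondecreasing as well.\<close>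

lemma nat_seq_mono_subseq:
  fixes s :: "nat \<Rightarrow> nat"
  obtains \<phi> :: "nat \<Rightarrow> nat" where "strict_mono \<phi>" "mono (\<lambda>k. s (\<phi> k))"
proof -
  obtain f where f: "strict_mono f" "monoseq (\<lambda>n. s (f n))"
    using seq_monosub[of s] by blast
  show thesis
  proof (cases "incseq (\<lambda>n. s (f n))")
    case True
    with f(1) show thesis by (rule that)
  next
    case False
    with f(2) have dec: "decseq (\<lambda>n. s (f n))" by (simp add: monoseq_iff)
    obtain N where N: "\<And>k. s (f N) \<le> s (f k)"
      using ex_has_least_nat[of "\<lambda>_. True" 0 "\<lambda>n. s (f n)"] by auto
    have "s (f (N + k)) = s (f N)" for k
      using N[of "N + k"] decseqD[OF dec, of N "N + k"] by simp
    moreover have "strict_mono (\<lambda>k. f (N + k))"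
      using f(1) by (simp add: strict_mono_def)
    ultimately show thesis using that[of "\<lambda>k. f (N + k)"] by (simp add: mono_def)
  qed
qed

text \<open>Dickson's lemma, by thinning out for one coordinate at a time: a further subsequence
  keeps the coordinates treated before nondecreasing. It supplies the hypothesis \<open>sub\<close>
  of \<open>higman\<close>.\<close>

lemma dickson_subseq:
  fixes f :: "nat \<Rightarrow> 'i \<Rightarrow> nat"
  assumes "finite I"
  shows "\<exists>\<phi> :: nat \<Rightarrow> nat. strict_mono \<phi> \<and> (\<forall>i\<in>I. mono (\<lambda>k. f (\<phi> k) i))"
  using assms
proof (induction I)
  case empty
  show ?case by (intro exI[of _ id]) (simp add: strict_mono_def)
next
  case (insert x I)
  then obtain \<phi> :: "nat \<Rightarrow> nat" where \<phi>: "strict_mono \<phi>" "\<forall>i\<in>I. mono (\<lambda>k. f (\<phi> k) i)" by blast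
  obtain \<psi> :: "nat \<Rightarrow> nat" where \<psi>: "strict_mono \<psi>" "mono (\<lambda>k. f (\<phi> (\<psi> k)) x)"
    by (rule nat_seq_mono_subseq[of "\<lambda>k. f (\<phi> k) x"])
  have "strict_mono (\<lambda>k. \<phi> (\<psi> k))" using \<phi>(1) \<psi>(1) by (simp add: strict_mono_def)
  moreover have "mono (\<lambda>k. f (\<phi> (\<psi> k)) i)" if "i \<in> I" for i
    using \<phi>(2) that strict_mono_mono[OF \<psi>(1)] by (simp add: mono_def)
  ultimately show ?case using \<psi>(2) by (intro exI[of _ "\<lambda>k. \<phi> (\<psi> k)"]) auto
qed

definition bad_seq :: "('a \<Rightarrow> 'a \<Rightarrow> bool) \<Rightarrow> (nat \<Rightarrow> 'a) \<Rightarrow> bool" where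
  "bad_seq Q w \<longleftrightarrow> (\<forall>i j. i < j \<longrightarrow> \<not> Q (w i) (w j))"

text \<open>Entries are fixed one by one, each of least size among the bad sequences that continue
  the entries fixed so far. Badness concerns two entries at a time, so the diagonal of the chosen
  sequences is again bad.\<close>

lemma minimal_bad_seq:
  fixes size :: "'a \<Rightarrow> nat"
  assumes "bad_seq Q w0"
  obtains m where "bad_seq Q m"
    "\<And>v n. bad_seq Q v \<Longrightarrow> \<forall>i<n. v i = m i \<Longrightarrow> size (m n) \<le> size (v n)"
proof -
  define P where "P n w \<longleftrightarrow> bad_seq Q w \<and>
      (\<forall>v. bad_seq Q v \<and> (\<forall>i<n. v i = w i) \<longrightarrow> size (w n) \<le> size (v n))" for n w
  have ex: "\<exists>v. P n v \<and> (\<forall>i<n. v i = w i)" if w: "bad_seq Q w" for w n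
  proof -
    obtain v where v: "bad_seq Q v \<and> (\<forall>i<n. v i = w i)"
      "\<forall>u. bad_seq Q u \<and> (\<forall>i<n. u i = w i) \<longrightarrow> size (v n) \<le> size (u n)"
      using ex_has_least_nat[of "\<lambda>v. bad_seq Q v \<and> (\<forall>i<n. v i = w i)" w "\<lambda>v. size (v n)"] w by blast
    then show ?thesis unfolding P_def by (intro exI[of _ v]) auto
  qed
  \<comment> \<open>\<open>W (Suc n)\<close> keeps the entries 0 to n of \<open>W n\<close> and is
    minimal at entry n + 1; thus entry i never changes from \<open>W i\<close> on.\<close>
  have "\<exists>W. \<forall>n. P n (W n) \<and> (\<forall>i<Suc n. W (Suc n) i = W n i)"
  proof (rule dependent_nat_choice)
    show "\<exists>w. P 0 w" using ex[OF assms] by blast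
    show "\<exists>v. P (Suc n) v \<and> (\<forall>i<Suc n. v i = w i)" if "P n w" for w n
      using ex that unfolding P_def by blast
  qed
  then obtain W where W: "\<And>n. P n (W n)" "\<And>n i. i \<le> n \<Longrightarrow> W (Suc n) i = W n i"
    by (auto simp: less_Suc_eq_le)
  have agree: "W (n + k) i = W n i" if "i \<le> n" for n k i
    using that by (induction k) (auto simp: W(2))
  have diag: "W n i = W i i" if "i \<le> n" for n i
    using agree[of i i "n - i"] that by simp
  show thesis
  proof
    show "bad_seq Q (\<lambda>n. W n n)"
      unfolding bad_seq_def
    proof (intro allI impI)
      fix i j :: nat assume "i < j"
      then show "\<not> Q (W i i) (W j j)"
        using W(1)[of j] diag[of i j] unfolding P_def bad_seq_def by force
    qed
    show "size (W n n) \<le> size (v n)" if "bad_seq Q v" "\<forall>i<n. v i = W i i" for v n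
    proof -
      have "\<forall>i<n. v i = W n i" using that(2) diag[of _ n] by simp
      then show ?thesis using W(1)[of n] that(1) unfolding P_def by blast
    qed
  qed
qed

text \<open>Nash-Williams: in a minimal bad sequence of words, replacing a tail by the remainders of words
  with increasing first letters gives a smaller bad sequence.\<close>

lemma higman:
  assumes sub: "\<And>a :: nat \<Rightarrow> 'a. \<exists>\<phi> :: nat \<Rightarrow> nat. strict_mono \<phi> \<and> (\<forall>i j. i < j \<longrightarrow> Q (a (\<phi> i)) (a (\<phi> j)))"
  shows "\<not> bad_seq (list_emb Q) w"
proof
  assume "bad_seq (list_emb Q) w"
  then obtain m where bad: "bad_seq (list_emb Q) m"
    and min: "\<And>v n. bad_seq (list_emb Q) v \<Longrightarrow> \<forall>i<n. v i = m i \<Longrightarrow> length (m n) \<le> length (v n)"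
    using minimal_bad_seq[of "list_emb Q" w length] by metis
  have notemb: "\<not> list_emb Q (m i) (m j)" if "i < j" for i j
    using bad that unfolding bad_seq_def by blast
  \<comment> \<open>The empty word embeds into every word, in particular into the next one.\<close>
  have ne: "m n \<noteq> []" for n
    using notemb[of n "Suc n"] by auto
  obtain \<phi> :: "nat \<Rightarrow> nat" where \<phi>: "strict_mono \<phi>" "\<forall>i j. i < j \<longrightarrow> Q (hd (m (\<phi> i))) (hd (m (\<phi> j)))"
    using sub[of "\<lambda>n. hd (m n)"] by auto
  define v where "v i = (if i < \<phi> 0 then m i else tl (m (\<phi> (i - \<phi> 0))))" for i
  have "bad_seq (list_emb Q) v"
    unfolding bad_seq_def
  proof (intro allI impI notI)
    fix i j :: nat
    assume ij: "i < j" and emb: "list_emb Q (v i) (v j)"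
    consider "j < \<phi> 0" | "i < \<phi> 0" "\<phi> 0 \<le> j" | "\<phi> 0 \<le> i"
      by linarith
    then show False
    proof cases
      case 1
      then show False using ij emb notemb unfolding v_def by auto
    next
      case 2
      \<comment> \<open>An embedding into the remainder of \<open>m ?k\<close> is also one into
        \<open>m ?k\<close>, which comes later than \<open>m i\<close>.\<close>
      let ?k = "\<phi> (j - \<phi> 0)"
      have "list_emb Q (m i) (hd (m ?k) # tl (m ?k))"
        using emb 2 unfolding v_def by (intro list_emb_Cons) auto
      moreover have "i < ?k"
        using 2 strict_mono_less_eq[OF \<phi>(1), of 0 "j - \<phi> 0"] by simp
      ultimately show False using notemb ne by simp
    next
      case 3
      \<comment> \<open>Putting back the first letters, which \<open>\<phi>\<close> makes
        comparable, turns an embedding of remainders into one of the full words.\<close>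
      let ?k = "\<phi> (i - \<phi> 0)" and ?l = "\<phi> (j - \<phi> 0)"
      have lt: "i - \<phi> 0 < j - \<phi> 0" using 3 ij by linarith
      have "list_emb Q (hd (m ?k) # tl (m ?k)) (hd (m ?l) # tl (m ?l))"
        using emb 3 ij \<phi>(2) lt unfolding v_def by (intro list_emb_Cons2) auto
      moreover have "?k < ?l" using lt \<phi>(1) by (simp add: strict_mono_def)
      ultimately show False using notemb ne by simp
    qed
  qed
  \<comment> \<open>Before \<open>\<phi> 0\<close> the sequence \<open>v\<close> agrees with
    \<open>m\<close>; at \<open>\<phi> 0\<close> it has the same word without its first letter,
    against minimality.\<close>
  from min[OF this, of "\<phi> 0"] have "length (m (\<phi> 0)) \<le> length (tl (m (\<phi> 0)))"
    by (simp add: v_def del: length_tl)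
  then show False using ne[of "\<phi> 0"] by (cases "m (\<phi> 0)") auto
qed

text \<open>\<open>p\<close> is defined on all naturals so that it can be turned into an element of
  \<open>Inc\<close>; past the end of \<open>xs\<close> it only has to increase.\<close>

lemma list_emb_imp_strict_mono:
  assumes "list_emb P xs ys"
  shows "\<exists>p :: nat \<Rightarrow> nat. strict_mono p \<and> (\<forall>k<length xs. p k < length ys \<and> P (xs ! k) (ys ! p k))"
  using assms
proof induction
  case (list_emb_Nil ys)
  show ?case by (intro exI[of _ id]) (simp add: strict_mono_def)
next
  case (list_emb_Cons xs ys y)
  then obtain p :: "nat \<Rightarrow> nat" where "strict_mono p" "\<forall>k<length xs. p k < length ys \<and> P (xs ! k) (ys ! p k)"
    by blast
  then show ?case by (intro exI[of _ "\<lambda>k. Suc (p k)"]) (auto simp: strict_mono_def)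
next
  case (list_emb_Cons2 x y xs ys)
  then obtain p :: "nat \<Rightarrow> nat" where p: "strict_mono p" "\<forall>k<length xs. p k < length ys \<and> P (xs ! k) (ys ! p k)"
    by blast
  \<comment> \<open>The new first letter goes to position 0, and the old embedding is shifted by one
    on both sides.\<close>
  let ?p = "\<lambda>k. case k of 0 \<Rightarrow> 0 | Suc k \<Rightarrow> Suc (p k)"
  have "strict_mono ?p" using p(1) by (auto simp: strict_mono_def split: nat.splits)
  moreover have "?p k < length (y # ys) \<and> P ((x # xs) ! k) ((y # ys) ! ?p k)"
    if "k < length (x # xs)" for k
    using that p(2) list_emb_Cons2(1) by (cases k) auto
  ultimately show ?case by blast
qed

text \<open>In the application \<open>\<L>\<close> has one set of pairs (n, leading monomial) per
  order, and \<open>K\<close> is the support of a polynomial tagged with n: reduced for one order,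
  it still has a leading monomial for each of the others.\<close>

lemma finite_separated_upsets:
  fixes Q :: "'a \<Rightarrow> 'a \<Rightarrow> bool"
  assumes wqo: "\<And>x. range x \<subseteq> X \<Longrightarrow> \<not> bad_seq Q x"
    and sub: "\<And>L. L \<in> \<L> \<Longrightarrow> L \<subseteq> X"
    and up: "\<And>L x y. L \<in> \<L> \<Longrightarrow> x \<in> L \<Longrightarrow> y \<in> X \<Longrightarrow> Q x y \<Longrightarrow> y \<in> L"
    and sep: "\<And>L x. L \<in> \<L> \<Longrightarrow> x \<in> L \<Longrightarrow>
                \<exists>K. finite K \<and> K \<inter> L = {x} \<and> (\<forall>L'\<in>\<L>. K \<inter> L' \<noteq> {})"
  shows "finite \<L>"
proof (rule ccontr)
  assume inf: "infinite \<L>"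
  define above where "above A = {L \<in> \<L>. A \<subseteq> L}" for A
  have step: "\<exists>B. infinite (above B) \<and> (\<exists>y. B = insert y A \<and> (\<forall>a\<in>A. \<not> Q a y))"
    if A: "infinite (above A)" for A
  proof -
    \<comment> \<open>\<open>U\<close> is the upset generated by \<open>A\<close>. Every member of
      \<open>above A\<close> contains it, and as there is more than one member, some
      \<open>L\<close> is strictly larger.\<close>
    define U where "U = {y \<in> X. \<exists>a\<in>A. Q a y}"
    have "\<not> above A \<subseteq> {U}" using A finite_subset by blast
    then obtain L where L: "L \<in> above A" "L \<noteq> U" by blast
    have "U \<subseteq> L" using L(1) up unfolding U_def above_def by blast
    with L(2) obtain x where x: "x \<in> L" "x \<notin> U" by blast
    from L(1) have "L \<in> \<L>" by (simp add: above_def)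
    then obtain K where K: "finite K" "K \<inter> L = {x}" "\<forall>L'\<in>\<L>. K \<inter> L' \<noteq> {}"
      using sep[OF _ x(1)] by blast
    \<comment> \<open>Pigeonhole: each member of \<open>above A\<close> meets the finite set
      \<open>K\<close>, so a single \<open>y\<close> in \<open>K\<close> lies in infinitely many of
      them.\<close>
    have "above A \<subseteq> (\<Union>y\<in>K. above (insert y A))"
    proof
      fix L' assume L': "L' \<in> above A"
      then have "L' \<in> \<L>" by (simp add: above_def)
      with K(3) obtain y where "y \<in> K" "y \<in> L'" by auto
      with L' show "L' \<in> (\<Union>y\<in>K. above (insert y A))" by (auto simp: above_def)
    qed
    then have "infinite (\<Union>y\<in>K. above (insert y A))"
      using A finite_subset by blast
    then obtain y where y: "y \<in> K" "infinite (above (insert y A))"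
      using K(1) by blast
    from y(2) obtain L' where "L' \<in> above (insert y A)"
      using infinite_imp_nonempty by blast
    then have "y \<in> X" using sub unfolding above_def by blast
    \<comment> \<open>Since \<open>U\<close> lies in \<open>L\<close> and \<open>K\<close> meets
      \<open>L\<close> only in \<open>x\<close>, an element of \<open>K\<close> in \<open>U\<close>
      would be \<open>x\<close>, which was chosen outside \<open>U\<close>.\<close>
    moreover have "y \<notin> U"
    proof
      assume "y \<in> U"
      then have "y \<in> K \<inter> L" using y(1) \<open>U \<subseteq> L\<close> by auto
      with K(2) x(2) \<open>y \<in> U\<close> show False by simp
    qed
    ultimately have "\<forall>a\<in>A. \<not> Q a y" unfolding U_def by blast
    with y(2) show ?thesis by blast
  qed
  \<comment> \<open>The start is \<open>{}\<close>, for which \<open>above {}\<close> is the whole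
    family.\<close>
  have "\<exists>A. \<forall>n::nat. infinite (above (A n)) \<and>
      (\<exists>y. A (Suc n) = insert y (A n) \<and> (\<forall>a\<in>A n. \<not> Q a y))"
    by (rule dependent_nat_choice) (use inf step in \<open>auto simp: above_def intro: exI[of _ "{}"]\<close>)
  then obtain A where A: "\<And>n::nat. infinite (above (A n))"
    "\<And>n. \<exists>y. A (Suc n) = insert y (A n) \<and> (\<forall>a\<in>A n. \<not> Q a y)" by blast
  obtain y where y: "\<And>n. A (Suc n) = insert (y n) (A n)" "\<And>n a. a \<in> A n \<Longrightarrow> \<not> Q a (y n)"
    using A(2) by metis
  have "y n \<in> X" for n
  proof -
    from A(1)[of "Suc n"] obtain L where "L \<in> above (A (Suc n))"
      using infinite_imp_nonempty by blast
    then show ?thesis using sub y(1)[of n] unfolding above_def by blast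
  qed
  moreover have "bad_seq Q y"
    unfolding bad_seq_def
  proof (intro allI impI)
    fix i j :: nat assume "i < j"
    then have "A (Suc i) \<subseteq> A j"
      using lift_Suc_mono_le[of A "Suc i" j] y(1) by auto
    then show "\<not> Q (y i) (y j)" using y by blast
  qed
  ultimately show False using wqo[of y] by auto
qed

section \<open>The action on monomials and polynomials\<close>

text \<open>\<open>mon_act\<close> and \<open>poly_act\<close> are both sums of this shape.
  Requiring injectivity at \<open>y\<close> too covers a \<open>y\<close> outside the support, where
  both sides are 0.\<close>

lemma lookup_sum_single_inj:
  fixes f :: "'a \<Rightarrow>\<^sub>0 'b::comm_monoid_add"
  assumes "inj_on h (insert y (Poly_Mapping.keys f))"
  shows "Poly_Mapping.lookup (\<Sum>x\<in>Poly_Mapping.keys f.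
           Poly_Mapping.single (h x) (Poly_Mapping.lookup f x)) (h y) = Poly_Mapping.lookup f y"
proof -
  have "Poly_Mapping.lookup (\<Sum>x\<in>Poly_Mapping.keys f.
           Poly_Mapping.single (h x) (Poly_Mapping.lookup f x)) (h y)
        = (\<Sum>x\<in>Poly_Mapping.keys f. if x = y then Poly_Mapping.lookup f x else 0)"
    unfolding lookup_sum
    by (rule sum.cong) (use assms in \<open>auto simp: lookup_single when_def inj_on_def\<close>)
  then show ?thesis by (simp add: in_keys_iff)
qed

lemma keys_sum_single_inj:
  fixes f :: "'a \<Rightarrow>\<^sub>0 'b::comm_monoid_add"
  assumes "inj_on h (Poly_Mapping.keys f)"
  shows "Poly_Mapping.keys (\<Sum>x\<in>Poly_Mapping.keys f.
           Poly_Mapping.single (h x) (Poly_Mapping.lookup f x)) = h ` Poly_Mapping.keys f"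
    (is "Poly_Mapping.keys ?F = _")
proof
  show "Poly_Mapping.keys ?F \<subseteq> h ` Poly_Mapping.keys f"
    using keys_sum[of "\<lambda>x. Poly_Mapping.single (h x) (Poly_Mapping.lookup f x)"] by fastforce
  show "h ` Poly_Mapping.keys f \<subseteq> Poly_Mapping.keys ?F"
  proof
    fix z assume "z \<in> h ` Poly_Mapping.keys f"
    then obtain y where y: "y \<in> Poly_Mapping.keys f" "z = h y" by blast
    then show "z \<in> Poly_Mapping.keys ?F"
      using lookup_sum_single_inj[of h y f] assms unfolding in_keys_iff[of z]
      by (simp add: insert_absorb in_keys_iff)
  qed
qed

lemma sum_single_lookup:
  fixes f :: "'a \<Rightarrow>\<^sub>0 'b::comm_monoid_add"
  shows "(\<Sum>x\<in>Poly_Mapping.keys f. Poly_Mapping.single x (Poly_Mapping.lookup f x)) = f"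
  by (rule poly_mapping_eqI) (use lookup_sum_single_inj[of "\<lambda>x. x" _ f] in simp)

lemma mon_act_eq_sum:
  "mon_act p t = (\<Sum>x\<in>Poly_Mapping.keys t.
     Poly_Mapping.single (map_prod id p x) (Poly_Mapping.lookup t x))"
  unfolding mon_act_def by (rule sum.cong) auto

lemma Inc_inj_on: "p \<in> Inc \<Longrightarrow> inj_on p {1..}"
  by (simp add: Inc_def strict_mono_on_imp_inj_on)

text \<open>Membership in \<open>Inc\<close> says nothing about \<open>p 0\<close>, hence the
  restriction to positive column indices.\<close>

lemma inj_on_map_prod_Inc:
  assumes "p \<in> Inc"
  shows "inj_on (map_prod id p) (UNIV \<times> {1..} :: (nat \<times> nat) set)"
  using Inc_inj_on[OF assms] by (auto simp: inj_on_def)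

lemma lookup_mon_act:
  assumes "p \<in> Inc" "t \<in> monomials c" "j \<ge> 1"
  shows "Poly_Mapping.lookup (mon_act p t) (i, p j) = Poly_Mapping.lookup t (i, j)"
proof -
  have "inj_on (map_prod id p) (insert (i, j) (Poly_Mapping.keys t))"
    by (rule inj_on_subset[OF inj_on_map_prod_Inc[OF assms(1)]])
       (use assms in \<open>auto simp: monomials_def\<close>)
  from lookup_sum_single_inj[OF this] show ?thesis by (simp add: mon_act_eq_sum)
qed

lemma keys_mon_act:
  assumes "p \<in> Inc" "t \<in> monomials c"
  shows "Poly_Mapping.keys (mon_act p t) = map_prod id p ` Poly_Mapping.keys t"
  unfolding mon_act_eq_sum
  by (intro keys_sum_single_inj inj_on_subset[OF inj_on_map_prod_Inc[OF assms(1)]])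
     (use assms in \<open>auto simp: monomials_def\<close>)

lemma inj_on_mon_act:
  assumes "p \<in> Inc"
  shows "inj_on (mon_act p) (monomials c)"
proof (rule inj_onI)
  fix s t assume st: "s \<in> monomials c" "t \<in> monomials c" "mon_act p s = mon_act p t"
  show "s = t"
  proof (rule poly_mapping_eqI)
    fix x :: "nat \<times> nat"
    obtain i j where x: "x = (i, j)" by force
    show "Poly_Mapping.lookup s x = Poly_Mapping.lookup t x"
    proof (cases "j \<ge> 1")
      case True
      then show ?thesis using lookup_mon_act[OF assms] st x by metis
    next
      case False
      then have "x \<notin> Poly_Mapping.keys s" "x \<notin> Poly_Mapping.keys t"
        using st x by (auto simp: monomials_def)
      then show ?thesis by (simp add: in_keys_iff)
    qed
  qed
qed

lemma monomials_upto_subset: "monomials_upto c n \<subseteq> monomials c"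
  by (auto simp: monomials_def monomials_upto_def)

text \<open>No terms merge or cancel, because \<open>mon_act p\<close> is injective on
  monomials.\<close>

lemma keys_poly_act:
  assumes "p \<in> Inc" "Poly_Mapping.keys f \<subseteq> monomials c"
  shows "Poly_Mapping.keys (poly_act p f) = mon_act p ` Poly_Mapping.keys f"
  unfolding poly_act_def
  by (intro keys_sum_single_inj inj_on_subset[OF inj_on_mon_act[OF assms(1)] assms(2)])

lemma keys_mult_single:
  fixes f :: "'k::field mpoly"
  shows "Poly_Mapping.keys (f * Poly_Mapping.single u 1) = (\<lambda>t. t + u) ` Poly_Mapping.keys f"
proof -
  have "f * Poly_Mapping.single u 1 = (\<Sum>t\<in>Poly_Mapping.keys f.
          Poly_Mapping.single t (Poly_Mapping.lookup f t)) * Poly_Mapping.single u 1"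
    by (simp add: sum_single_lookup)
  also have "\<dots> = (\<Sum>t\<in>Poly_Mapping.keys f.
          Poly_Mapping.single (t + u) (Poly_Mapping.lookup f t))"
    by (simp add: sum_distrib_right mult_single)
  finally show ?thesis
    using keys_sum_single_inj[of "\<lambda>t. t + u" f] by (simp add: inj_on_def)
qed

section \<open>Inc-divisibility\<close>

text \<open>The first component records the ring R_n in which a monomial is considered: it may be a
  leading monomial of J_n without being one of an earlier J_m.\<close>

definition Inc_divides :: "nat \<Rightarrow> nat \<times> mon \<Rightarrow> nat \<times> mon \<Rightarrow> bool" where
  "Inc_divides c x y \<longleftrightarrow> fst x \<le> fst y \<and> (\<exists>p\<in>Inc_between (fst x) (fst y).
     \<exists>u\<in>monomials_upto c (fst y). snd y = mon_act p (snd x) + u)"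

definition indexed_monomials :: "nat \<Rightarrow> (nat \<times> mon) set" where
  "indexed_monomials c = (SIGMA n:{1..}. monomials_upto c n)"

lemma Inc_ge_self:
  assumes "p \<in> Inc" "j \<ge> 1"
  shows "j \<le> p j"
  using assms(2)
proof (induction j rule: dec_induct)
  case base
  then show ?case using assms(1) by (auto simp: Inc_def)
next
  case (step j)
  then have "p j < p (Suc j)"
    using assms(1) unfolding Inc_def by (auto simp: strict_mono_on_def)
  with step show ?case by simp
qed

text \<open>A monomial of R_n is read as a word of length n whose letters are its columns of
  exponents. The embedding tells where to move the columns of \<open>s\<close>; what remains of
  \<open>t\<close> is the cofactor.\<close>

lemma Inc_divides_if_list_emb:
  assumes m: "m \<ge> 1" and s: "s \<in> monomials_upto c m" and t: "t \<in> monomials_upto c n"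
    and emb: "list_emb (\<lambda>f g. \<forall>i\<in>{1..c}. f i \<le> g i)
      (map (\<lambda>j i. Poly_Mapping.lookup s (i, Suc j)) [0..<m])
      (map (\<lambda>j i. Poly_Mapping.lookup t (i, Suc j)) [0..<n])"
  shows "Inc_divides c (m, s) (n, t)"
proof -
  obtain p :: "nat \<Rightarrow> nat" where p: "strict_mono p"
    "\<And>k. k < m \<Longrightarrow> p k < n \<and> (\<forall>i\<in>{1..c}.
        Poly_Mapping.lookup s (i, Suc k) \<le> Poly_Mapping.lookup t (i, Suc (p k)))"
    using list_emb_imp_strict_mono[OF emb] by (auto cong: conj_cong)
  \<comment> \<open>Letters are counted from 0 and columns from 1; the value \<open>q 0\<close> does
    not affect membership in \<open>Inc\<close>.\<close>
  define q where "q j = Suc (p (j - 1))" for j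
  have q: "q \<in> Inc"
    using p(1) by (auto simp: Inc_def q_def strict_mono_on_def strict_mono_def)
  have "p (m - 1) < n" using p(2)[of "m - 1"] m by auto
  then have qm: "q m \<le> n" by (simp add: q_def)
  have sc: "s \<in> monomials c" using s monomials_upto_subset by blast
  have le: "Poly_Mapping.lookup (mon_act q s) x \<le> Poly_Mapping.lookup t x" for x
  proof (cases "x \<in> Poly_Mapping.keys (mon_act q s)")
    case True
    then obtain i j where ij: "(i, j) \<in> Poly_Mapping.keys s" "x = (i, q j)"
      unfolding keys_mon_act[OF q sc] by auto
    then have "i \<in> {1..c}" "1 \<le> j" "j \<le> m" using s by (auto simp: monomials_upto_def)
    then show ?thesis
      using p(2)[of "j - 1"] lookup_mon_act[OF q sc, of j i] ij(2) by (simp add: q_def)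
  qed (simp add: in_keys_iff)
  \<comment> \<open>Subtraction of exponents is truncated; \<open>le\<close> makes it exact.\<close>
  have "t = mon_act q s + (t - mon_act q s)"
    by (rule poly_mapping_eqI) (use le in \<open>simp add: lookup_add lookup_minus\<close>)
  moreover have "t - mon_act q s \<in> monomials_upto c n"
  proof -
    have "Poly_Mapping.keys (t - mon_act q s) \<subseteq> Poly_Mapping.keys t"
      by (auto simp: in_keys_iff lookup_minus)
    then show ?thesis using t unfolding monomials_upto_def by blast
  qed
  moreover have "m \<le> n" using Inc_ge_self[OF q m] qm by simp
  ultimately show ?thesis
    using q qm unfolding Inc_divides_def Inc_between_def fst_conv snd_conv by blast
qed

text \<open>Dickson's lemma handles the letters, vectors of c exponents, and Higman's lemma the
  words.\<close>

lemma Inc_divides_wqo: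
  assumes "range x \<subseteq> indexed_monomials c"
  shows "\<not> bad_seq (Inc_divides c) x"
proof -
  let ?le = "\<lambda>f g :: nat \<Rightarrow> nat. \<forall>i\<in>{1..c}. f i \<le> g i"
  define w where "w k = map (\<lambda>j i. Poly_Mapping.lookup (snd (x k)) (i, Suc j)) [0..<fst (x k)]" for k
  have "\<exists>\<phi> :: nat \<Rightarrow> nat. strict_mono \<phi> \<and> (\<forall>i j. i < j \<longrightarrow> ?le (a (\<phi> i)) (a (\<phi> j)))" for a :: "nat \<Rightarrow> nat \<Rightarrow> nat"
  proof -
    obtain \<phi> :: "nat \<Rightarrow> nat" where "strict_mono \<phi>" "\<forall>i\<in>{1..c}. mono (\<lambda>k. a (\<phi> k) i)"
      using dickson_subseq[of "{1..c}" a] by auto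
    then show ?thesis by (intro exI[of _ \<phi>]) (auto simp: mono_def)
  qed
  then have "\<not> bad_seq (list_emb ?le) w" by (rule higman)
  then obtain i j where ij: "i < j" "list_emb ?le (w i) (w j)" unfolding bad_seq_def by blast
  have "fst (x k) \<ge> 1" "snd (x k) \<in> monomials_upto c (fst (x k))" for k
  proof -
    have "x k \<in> indexed_monomials c" using assms by blast
    then show "fst (x k) \<ge> 1" "snd (x k) \<in> monomials_upto c (fst (x k))"
      unfolding indexed_monomials_def by (cases "x k"; simp)+
  qed
  then have "Inc_divides c (x i) (x j)"
    using Inc_divides_if_list_emb[of "fst (x i)" "snd (x i)" c "snd (x j)" "fst (x j)"] ij(2)
    unfolding w_def by simp
  with ij(1) show ?thesis unfolding bad_seq_def by blast
qed

section \<open>Leading monomials\<close>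

lemma term_orderD:
  assumes "term_order c r"
  shows "(s, t) \<in> r \<Longrightarrow> s \<in> monomials c \<and> t \<in> monomials c"
    and "s \<in> monomials c \<Longrightarrow> (s, s) \<in> r"
    and "(s, t) \<in> r \<Longrightarrow> (t, u) \<in> r \<Longrightarrow> (s, u) \<in> r"
    and "(s, t) \<in> r \<Longrightarrow> (t, s) \<in> r \<Longrightarrow> s = t"
    and "s \<in> monomials c \<Longrightarrow> t \<in> monomials c \<Longrightarrow> (s, t) \<in> r \<or> (t, s) \<in> r"
    and "u \<in> monomials c \<Longrightarrow> (s, t) \<in> r \<Longrightarrow> (s + u, t + u) \<in> r"
    and "t \<in> monomials c \<Longrightarrow> (0, t) \<in> r"
proof -
  have lin: "linear_order_on (monomials c) r"
    and add: "\<forall>s t. \<forall>u\<in>monomials c. (s, t) \<in> r \<longrightarrow> (s + u, t + u) \<in> r"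
    and zero: "\<forall>t\<in>monomials c. (0, t) \<in> r"
    by (rule conjunct1[OF assms[unfolded term_order_def]]
          conjunct1[OF conjunct2[OF assms[unfolded term_order_def]]]
          conjunct2[OF conjunct2[OF assms[unfolded term_order_def]]])+
  from lin have refl: "refl_on (monomials c) r" and rsub: "r \<subseteq> monomials c \<times> monomials c"
    and tot: "total_on (monomials c) r" and trans: "trans r" and antisym: "antisym r"
    by (simp_all add: order_on_defs)
  show "(s, t) \<in> r \<Longrightarrow> s \<in> monomials c \<and> t \<in> monomials c" using rsub by blast
  show "s \<in> monomials c \<Longrightarrow> (s, s) \<in> r" using refl by (rule refl_onD)
  show "(s, t) \<in> r \<Longrightarrow> (t, u) \<in> r \<Longrightarrow> (s, u) \<in> r" by (rule transD[OF trans])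
  show "(s, t) \<in> r \<Longrightarrow> (t, s) \<in> r \<Longrightarrow> s = t" by (rule antisymD[OF antisym])
  show "(s, t) \<in> r \<or> (t, s) \<in> r" if "s \<in> monomials c" "t \<in> monomials c"
    using tot that refl_onD[OF refl that(1)] unfolding total_on_def by (cases "s = t") auto
  show "u \<in> monomials c \<Longrightarrow> (s, t) \<in> r \<Longrightarrow> (s + u, t + u) \<in> r"
    using add by blast
  show "t \<in> monomials c \<Longrightarrow> (0, t) \<in> r" using zero by blast
qed

text \<open>A nonempty finite set has a maximum in a total order, so the definite description in
  \<open>leading_mon\<close> does denote.\<close>

lemma leading_mon_props:
  assumes r: "term_order c r" and f: "f \<noteq> 0" "Poly_Mapping.keys f \<subseteq> monomials c"
  shows "leading_mon r f \<in> Poly_Mapping.keys f"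
    and "s \<in> Poly_Mapping.keys f \<Longrightarrow> (s, leading_mon r f) \<in> r"
proof -
  have "\<exists>t\<in>S. \<forall>s\<in>S. (s, t) \<in> r" if "finite S" "S \<noteq> {}" "S \<subseteq> monomials c" for S
    using that
  proof (induction rule: finite_ne_induct)
    case (singleton x)
    then show ?case using term_orderD(2)[OF r] by auto
  next
    case (insert x F)
    then obtain t where t: "t \<in> F" "\<forall>s\<in>F. (s, t) \<in> r" by auto
    show ?case
    proof (cases "(x, t) \<in> r")
      case True
      then show ?thesis using t by auto
    next
      case False
      then have "(t, x) \<in> r" "(x, x) \<in> r"
        using insert.prems t(1) term_orderD(2,5)[OF r] by blast+
      then show ?thesis using t term_orderD(3)[OF r] by blast
    qed
  qed
  from this[of "Poly_Mapping.keys f"] obtain t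
    where t: "t \<in> Poly_Mapping.keys f" "\<forall>s\<in>Poly_Mapping.keys f. (s, t) \<in> r"
    using f by auto
  then have "leading_mon r f = t" by (intro leading_mon_eqI[OF r]) auto
  with t show "leading_mon r f \<in> Poly_Mapping.keys f"
    and "s \<in> Poly_Mapping.keys f \<Longrightarrow> (s, leading_mon r f) \<in> r" by auto
qed

text \<open>In a descending chain some \<open>f i\<close> would Inc-divide a later
  \<open>f j\<close> with the same n. An increasing map with p(n) \<le> n fixes 1, ..., n, so this
  is ordinary divisibility, which forces \<open>f i\<close> below \<open>f j\<close>.\<close>

lemma wf_term_order_upto:
  assumes r: "term_order c r" and n: "n \<ge> 1"
  shows "wf {(s, t). (s, t) \<in> r \<and> s \<noteq> t \<and> s \<in> monomials_upto c n \<and> t \<in> monomials_upto c n}"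
  unfolding wf_iff_no_infinite_down_chain
proof
  assume "\<exists>f. \<forall>i. (f (Suc i), f i) \<in> {(s, t). (s, t) \<in> r \<and> s \<noteq> t \<and>
      s \<in> monomials_upto c n \<and> t \<in> monomials_upto c n}"
  then obtain f where f: "\<And>i. (f (Suc i), f i) \<in> r" "\<And>i. f (Suc i) \<noteq> f i"
    "\<And>i. f i \<in> monomials_upto c n" by blast
  have mono: "(f (i + k), f i) \<in> r" for i k
  proof (induction k)
    case 0
    show ?case using f(3)[of i] monomials_upto_subset term_orderD(2)[OF r] by auto
  next
    case (Suc k)
    then show ?case using f(1)[of "i + k"] term_orderD(3)[OF r] by simp
  qed
  have "range (\<lambda>k. (n, f k)) \<subseteq> indexed_monomials c"
    using f(3) n by (auto simp: indexed_monomials_def)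
  from Inc_divides_wqo[OF this] obtain i j
    where ij: "i < j" "Inc_divides c (n, f i) (n, f j)" unfolding bad_seq_def by blast
  then obtain p u where p: "p \<in> Inc" "p n \<le> n" and u: "u \<in> monomials_upto c n"
    and eq: "f j = mon_act p (f i) + u"
    unfolding Inc_divides_def Inc_between_def by auto
  \<comment> \<open>\<open>p\<close> gains at least 1 per step, so p(j) > j for some j \<le> n would
    give p(n) > n.\<close>
  have less: "p j + k \<le> p (j + k)" if "j \<ge> 1" for j k
  proof (induction k)
    case (Suc k)
    have "p (j + k) < p (j + Suc k)"
      using p(1) that by (auto simp: Inc_def strict_mono_on_def)
    with Suc show ?case by simp
  qed simp
  have id: "p j = j" if "1 \<le> j" "j \<le> n" for j
    using less[of j "n - j"] Inc_ge_self[OF p(1), of j] that p(2) by simp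
  have "mon_act p (f i) = (\<Sum>x\<in>Poly_Mapping.keys (f i).
      Poly_Mapping.single x (Poly_Mapping.lookup (f i) x))"
    unfolding mon_act_eq_sum
    by (rule sum.cong) (use f(3)[of i] id in \<open>auto simp: monomials_upto_def\<close>)
  then have "f j = f i + u" using eq by (simp add: sum_single_lookup)
  moreover have "u \<in> monomials c" using u monomials_upto_subset by blast
  then have "(0 + f i, u + f i) \<in> r"
    using f(3)[of i] monomials_upto_subset by (intro term_orderD(6,7)[OF r]) auto
  ultimately have "(f i, f j) \<in> r" by (simp add: add.commute)
  \<comment> \<open>Now \<open>f i\<close> is below \<open>f j\<close>, which is below
    \<open>f (Suc i)\<close>, against the strict descent.\<close>
  moreover have "(f j, f (Suc i)) \<in> r" using mono[of "Suc i" "j - Suc i"] ij(1) by simp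
  ultimately have "(f i, f (Suc i)) \<in> r" using term_orderD(3)[OF r] by blast
  then show False using f(1,2)[of i] term_orderD(4)[OF r] by metis
qed

lemma lookup_smult: "Poly_Mapping.lookup (Poly_Mapping.single 0 a * f) t = a * Poly_Mapping.lookup f t"
  for f :: "'k::field mpoly"
proof -
  have "Poly_Mapping.single 0 a * f = (\<Sum>s\<in>Poly_Mapping.keys f.
      Poly_Mapping.single s (a * Poly_Mapping.lookup f s))"
    by (subst (1) sum_single_lookup[of f, symmetric])
       (simp add: sum_distrib_left mult_single)
  then have "Poly_Mapping.lookup (Poly_Mapping.single 0 a * f) t = 
     (\<Sum>s\<in>Poly_Mapping.keys f. if s = t then a * Poly_Mapping.lookup f s else 0)"
    by (simp add: lookup_sum lookup_single when_def)
  then show ?thesis by (simp add: in_keys_iff)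
qed

lemma keys_smult_subset: "Poly_Mapping.keys (Poly_Mapping.single 0 a * f) \<subseteq> Poly_Mapping.keys f"
  for f :: "'k::field mpoly"
  by (auto simp: in_keys_iff lookup_smult)

text \<open>Division with remainder modulo \<open>I\<close>. The bound on the monomials of \<open>h\<close> is needed when the
  tail of some \<open>f \<in> I\<close> is reduced: then \<open>s\<close> is the leading monomial of \<open>f\<close> and must survive.\<close>

lemma reduce_below:
  fixes I :: "'k::field mpoly set"
  assumes r: "term_order c r" and n: "n \<ge> 1"
    and sub: "\<And>f. f \<in> I \<Longrightarrow> Poly_Mapping.keys f \<subseteq> monomials_upto c n"
    and zero: "0 \<in> I" and add: "\<And>f g. f \<in> I \<Longrightarrow> g \<in> I \<Longrightarrow> f + g \<in> I"
    and smult: "\<And>a f. f \<in> I \<Longrightarrow> Poly_Mapping.single 0 a * f \<in> I"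
    and "s \<in> monomials_upto c n" "Poly_Mapping.keys g \<subseteq> monomials_upto c n"
    and "\<And>t. t \<in> Poly_Mapping.keys g \<Longrightarrow> (t, s) \<in> r \<and> t \<noteq> s"
  shows "\<exists>h\<in>I. (\<forall>t\<in>Poly_Mapping.keys h. (t, s) \<in> r \<and> t \<noteq> s) \<and>
           Poly_Mapping.keys (g - h) \<inter> {leading_mon r f | f. f \<in> I \<and> f \<noteq> 0} = {}"
  using wf_term_order_upto[OF r n] assms(7-9)
\<comment> \<open>The induction runs over the strict bound \<open>s\<close>; the leading monomial
  \<open>t\<close> of \<open>g\<close> becomes the next bound once it is set aside or
  cancelled.\<close>
proof (induction s arbitrary: g rule: wf_induct_rule)
  case (less s)
  let ?L = "{leading_mon r f | f. f \<in> I \<and> f \<noteq> 0}"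
  show ?case
  proof (cases "g = 0")
    case True
    then show ?thesis using zero by (intro bexI[of _ 0]) auto
  next
    case False
    define t where "t = leading_mon r g"
    have gc: "Poly_Mapping.keys g \<subseteq> monomials c"
      using less.prems(2) monomials_upto_subset by blast
    have t: "t \<in> Poly_Mapping.keys g" "\<And>u. u \<in> Poly_Mapping.keys g \<Longrightarrow> (u, t) \<in> r"
      unfolding t_def using leading_mon_props[OF r False gc] by auto
    have ts: "(t, s) \<in> r" "t \<noteq> s" "t \<in> monomials_upto c n"
      using less.prems t(1) by auto
    have below: "(u, s) \<in> r \<and> u \<noteq> s" if "(u, t) \<in> r" for u
      using that ts term_orderD(3,4)[OF r] by metis
    have IH: "\<exists>h\<in>I. (\<forall>u\<in>Poly_Mapping.keys h. (u, t) \<in> r \<and> u \<noteq> t) \<and>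
           Poly_Mapping.keys (g' - h) \<inter> ?L = {}"
      if "Poly_Mapping.keys g' \<subseteq> monomials_upto c n"
        "\<And>u. u \<in> Poly_Mapping.keys g' \<Longrightarrow> (u, t) \<in> r \<and> u \<noteq> t" for g'
      by (rule less.IH) (use ts less.prems(1) that in auto)
    show ?thesis
    proof (cases "t \<in> ?L")
      case False
      \<comment> \<open>\<open>t\<close> is allowed in a remainder: its term \<open>a\<close> is set
        aside, the rest is reduced, and putting \<open>a\<close> back adds at most \<open>t\<close>
        to the support.\<close>
      define a where "a = Poly_Mapping.single t (Poly_Mapping.lookup g t)"
      have ka: "Poly_Mapping.keys (g - a) = Poly_Mapping.keys g - {t}"
        by (auto simp: in_keys_iff lookup_minus lookup_single when_def a_def split: if_splits)
      obtain h where h: "h \<in> I" "\<forall>u\<in>Poly_Mapping.keys h. (u, t) \<in> r \<and> u \<noteq> t"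
        "Poly_Mapping.keys (g - a - h) \<inter> ?L = {}"
        using IH[of "g - a"] less.prems(2) t(2) unfolding ka by blast
      have "Poly_Mapping.keys (g - h) \<subseteq> insert t (Poly_Mapping.keys (g - a - h))"
        by (auto simp: in_keys_iff lookup_minus lookup_single when_def a_def split: if_splits)
      then have "Poly_Mapping.keys (g - h) \<inter> ?L = {}" using h(3) False by blast
      then show ?thesis using h(1,2) below by blast
    next
      case True
      then obtain f where f: "f \<in> I" "f \<noteq> 0" "t = leading_mon r f" by blast
      have fc: "Poly_Mapping.keys f \<subseteq> monomials c"
        using sub[OF f(1)] monomials_upto_subset by blast
      have ft: "t \<in> Poly_Mapping.keys f" "\<And>u. u \<in> Poly_Mapping.keys f \<Longrightarrow> (u, t) \<in> r"
        unfolding f(3) using leading_mon_props[OF r f(2) fc] by auto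
      \<comment> \<open>\<open>?L\<close> contains all leading monomials of \<open>I\<close>, not
        just generators, so a scalar multiple of \<open>f\<close> cancels the leading term of
        \<open>g\<close>.\<close>
      define a where "a = Poly_Mapping.single 0
        (Poly_Mapping.lookup g t / Poly_Mapping.lookup f t) * f"
      have aI: "a \<in> I" unfolding a_def by (rule smult[OF f(1)])
      have ka: "Poly_Mapping.keys a \<subseteq> Poly_Mapping.keys f"
        unfolding a_def by (rule keys_smult_subset)
      have "Poly_Mapping.lookup (g - a) t = 0"
        using ft(1) unfolding a_def lookup_minus lookup_smult by (simp add: in_keys_iff)
      then have kt: "t \<notin> Poly_Mapping.keys (g - a)" by (simp add: in_keys_iff)
      have kga: "Poly_Mapping.keys (g - a) \<subseteq> Poly_Mapping.keys g \<union> Poly_Mapping.keys f"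
        using keys_diff[of g a] ka by blast
      have "\<exists>h\<in>I. (\<forall>u\<in>Poly_Mapping.keys h. (u, t) \<in> r \<and> u \<noteq> t) \<and>
           Poly_Mapping.keys (g - a - h) \<inter> ?L = {}"
      proof (rule IH)
        show "Poly_Mapping.keys (g - a) \<subseteq> monomials_upto c n"
          using kga less.prems(2) sub[OF f(1)] by (meson Un_least order_trans)
        show "(u, t) \<in> r \<and> u \<noteq> t" if "u \<in> Poly_Mapping.keys (g - a)" for u
          using that kt kga t(2) ft(2) by (cases "u = t") auto
      qed
      then obtain h where h: "h \<in> I" "\<forall>u\<in>Poly_Mapping.keys h. (u, t) \<in> r \<and> u \<noteq> t"
        "Poly_Mapping.keys (g - a - h) \<inter> ?L = {}" by blast
      show ?thesis
      proof (intro bexI[of _ "a + h"] conjI)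
        show "a + h \<in> I" by (rule add[OF aI h(1)])
        show "\<forall>u\<in>Poly_Mapping.keys (a + h). (u, s) \<in> r \<and> u \<noteq> s"
          using keys_add[of a h] ka ft(2) h(2) below by blast
        show "Poly_Mapping.keys (g - (a + h)) \<inter> ?L = {}"
          using h(3) by (simp add: diff_diff_eq)
      qed
    qed
  qed
qed

text \<open>Take an element with leading monomial \<open>t\<close> and reduce its tail modulo
  \<open>I\<close>. The polynomial subtracted has only monomials strictly below \<open>t\<close>, so
  \<open>t\<close> survives while all other leading monomials disappear.\<close>

lemma exists_reduced:
  fixes I :: "'k::field mpoly set"
  assumes r: "term_order c r" and n: "n \<ge> 1"
    and sub: "\<And>f. f \<in> I \<Longrightarrow> Poly_Mapping.keys f \<subseteq> monomials_upto c n"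
    and zero: "0 \<in> I" and add: "\<And>f g. f \<in> I \<Longrightarrow> g \<in> I \<Longrightarrow> f + g \<in> I"
    and smult: "\<And>a f. f \<in> I \<Longrightarrow> Poly_Mapping.single 0 a * f \<in> I"
    and t: "t \<in> {leading_mon r f | f. f \<in> I \<and> f \<noteq> 0}"
  shows "\<exists>f\<in>I. Poly_Mapping.keys f \<inter> {leading_mon r f | f. f \<in> I \<and> f \<noteq> 0} = {t}"
proof -
  let ?L = "{leading_mon r f | f. f \<in> I \<and> f \<noteq> 0}"
  from t obtain f where f: "f \<in> I" "f \<noteq> 0" "t = leading_mon r f" by blast
  have fc: "Poly_Mapping.keys f \<subseteq> monomials c"
    using sub[OF f(1)] monomials_upto_subset by blast
  have ft: "t \<in> Poly_Mapping.keys f" "\<And>u. u \<in> Poly_Mapping.keys f \<Longrightarrow> (u, t) \<in> r"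
    unfolding f(3) using leading_mon_props[OF r f(2) fc] by auto
  define a where "a = Poly_Mapping.single t (Poly_Mapping.lookup f t)"
  have ka: "Poly_Mapping.keys (f - a) = Poly_Mapping.keys f - {t}"
    by (auto simp: in_keys_iff lookup_minus lookup_single when_def a_def split: if_splits)
  have "\<exists>h\<in>I. (\<forall>u\<in>Poly_Mapping.keys h. (u, t) \<in> r \<and> u \<noteq> t) \<and>
           Poly_Mapping.keys (f - a - h) \<inter> ?L = {}"
    by (rule reduce_below[OF r n sub zero add smult])
       (use sub[OF f(1)] ft ka in auto)
  then obtain h where h: "h \<in> I" "\<forall>u\<in>Poly_Mapping.keys h. (u, t) \<in> r \<and> u \<noteq> t"
    "Poly_Mapping.keys (f - a - h) \<inter> ?L = {}" by blast
  have "Poly_Mapping.single 0 (- 1) * h = - h"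
    by (rule poly_mapping_eqI) (simp add: lookup_smult)
  then have "f - h \<in> I" using add[OF f(1) smult[OF h(1), of "- 1"]] by simp
  moreover have "Poly_Mapping.keys (f - h) \<subseteq> insert t (Poly_Mapping.keys (f - a - h))"
    by (auto simp: in_keys_iff lookup_minus lookup_single when_def a_def split: if_splits)
  moreover have "t \<in> Poly_Mapping.keys (f - h)"
    using ft(1) h(2) by (auto simp: in_keys_iff lookup_minus)
  ultimately show ?thesis using h(3) t by (intro bexI[of _ "f - h"]) auto
qed

section \<open>Finiteness\<close>

definition leading_pairs :: "mon rel \<Rightarrow> (nat \<Rightarrow> 'k::field mpoly set) \<Rightarrow> (nat \<times> mon) set" where
  "leading_pairs r J = (SIGMA n:{1..}. {leading_mon r f | f. f \<in> J n \<and> f \<noteq> 0})"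

text \<open>The order enters the initial chain only through \<open>leading_pairs\<close>, so it
  suffices to bound the number of these sets.\<close>

lemma initial_chain_eq:
  "initial_chain c r J = (\<lambda>n\<in>{1..}. Idl\<^bsub>poly_ring_upto c n\<^esub>
     ((\<lambda>t. Poly_Mapping.single t 1) ` (leading_pairs r J `` {n})))"
proof -
  have "initial_ideal c n r (J n) = Idl\<^bsub>poly_ring_upto c n\<^esub>
     ((\<lambda>t. Poly_Mapping.single t 1) ` (leading_pairs r J `` {n}))" if "n \<ge> 1" for n
  proof -
    have "leading_pairs r J `` {n} = {leading_mon r f | f. f \<in> J n \<and> f \<noteq> 0}"
      using that unfolding leading_pairs_def by auto
    then show ?thesis
      unfolding initial_ideal_def by (simp only: setcompr_eq_image image_image)
  qed
  then show ?thesis unfolding initial_chain_def by (intro restrict_ext) simp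
qed

lemma Inc_invariant_chainD:
  assumes "Inc_invariant_chain c J" "n \<ge> 1"
  shows "f \<in> J n \<Longrightarrow> Poly_Mapping.keys f \<subseteq> monomials_upto c n"
    and "0 \<in> J n" and "f \<in> J n \<Longrightarrow> g \<in> J n \<Longrightarrow> f + g \<in> J n"
    and "f \<in> J n \<Longrightarrow> Poly_Mapping.keys g \<subseteq> monomials_upto c n \<Longrightarrow> g * f \<in> J n"
proof -
  interpret ideal "J n" "poly_ring_upto c n"
    using assms unfolding Inc_invariant_chain_def by blast
  show "f \<in> J n \<Longrightarrow> Poly_Mapping.keys f \<subseteq> monomials_upto c n"
    using a_subset by (auto simp: poly_ring_upto_def)
  show "0 \<in> J n"
    using additive_subgroup.zero_closed[OF additive_subgroup_axioms] by (simp add: poly_ring_upto_def)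
  show "f \<in> J n \<Longrightarrow> g \<in> J n \<Longrightarrow> f + g \<in> J n"
    using additive_subgroup.a_closed[OF additive_subgroup_axioms, of f g] by (simp add: poly_ring_upto_def)
  show "f \<in> J n \<Longrightarrow> Poly_Mapping.keys g \<subseteq> monomials_upto c n \<Longrightarrow> g * f \<in> J n"
    using I_l_closed[of f g] by (simp add: poly_ring_upto_def)
qed

text \<open>If \<open>f\<close> has leading monomial \<open>s\<close>, then p.f times
  \<open>u\<close> lies in J_n. Compatibility with \<open>p\<close> and with multiplication by
  \<open>u\<close> keeps the image of \<open>s\<close> on top.\<close>

lemma leading_pairs_upclosed:
  assumes J: "Inc_invariant_chain c J" and r: "term_order c r" "Inc_compatible r"
    and x: "x \<in> leading_pairs r J" and le: "Inc_divides c x y"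
  shows "y \<in> leading_pairs r J"
proof -
  obtain m s n t where xy: "x = (m, s)" "y = (n, t)" by (metis surj_pair)
  obtain f where m: "m \<ge> 1" and f: "f \<in> J m" "f \<noteq> 0" "s = leading_mon r f"
    using x xy unfolding leading_pairs_def by auto
  obtain p u where mn: "m \<le> n" and p: "p \<in> Inc_between m n"
    and u: "u \<in> monomials_upto c n" and t: "t = mon_act p s + u"
    using le xy unfolding Inc_divides_def by auto
  have pI: "p \<in> Inc" using p by (simp add: Inc_between_def)
  have n: "n \<ge> 1" using m mn by simp
  have uc: "u \<in> monomials c" using u monomials_upto_subset by blast
  have fc: "Poly_Mapping.keys f \<subseteq> monomials c"
    using Inc_invariant_chainD(1)[OF J m f(1)] monomials_upto_subset by blast
  define g where "g = poly_act p f * Poly_Mapping.single u 1"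
  have "poly_act p f \<in> J n"
    using J m mn p f(1) unfolding Inc_invariant_chain_def by blast
  then have "g \<in> J n"
    unfolding g_def
    by (subst mult.commute) (intro Inc_invariant_chainD(4)[OF J n], use u in auto)
  have kg: "Poly_Mapping.keys g = (\<lambda>t. mon_act p t + u) ` Poly_Mapping.keys f"
    unfolding g_def keys_mult_single keys_poly_act[OF pI fc] by (simp add: image_image)
  have s: "s \<in> Poly_Mapping.keys f" "\<And>v. v \<in> Poly_Mapping.keys f \<Longrightarrow> (v, s) \<in> r"
    unfolding f(3) using leading_mon_props[OF r(1) f(2) fc] by auto
  have "leading_mon r g = t"
  proof (rule leading_mon_eqI[OF r(1)])
    show "t \<in> Poly_Mapping.keys g" using kg t s(1) by blast
    fix v assume "v \<in> Poly_Mapping.keys g"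
    then obtain w where w: "w \<in> Poly_Mapping.keys f" "v = mon_act p w + u"
      unfolding kg by blast
    have "(mon_act p w, mon_act p s) \<in> r"
      using r(2) pI s(2)[OF w(1)] unfolding Inc_compatible_def by blast
    then show "(v, t) \<in> r" unfolding w(2) t by (rule term_orderD(6)[OF r(1) uc])
  qed
  moreover have "g \<noteq> 0" using kg s(1) by auto
  ultimately show ?thesis
    using \<open>g \<in> J n\<close> n xy unfolding leading_pairs_def by auto
qed

lemma finite_leading_pairs:
  assumes J: "Inc_invariant_chain c J"
  shows "finite {leading_pairs r J | r. term_order c r \<and> Inc_compatible r}"
proof (rule finite_separated_upsets[of "indexed_monomials c" "Inc_divides c"])
  note D = Inc_invariant_chainD[OF J]
  have lead: "leading_mon r f \<in> Poly_Mapping.keys f"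
    if "term_order c r" "n \<ge> 1" "f \<in> J n" "f \<noteq> 0" for r n f
    using leading_mon_props(1)[OF that(1,4)] D(1)[OF that(2,3)] monomials_upto_subset by blast
  show "\<not> bad_seq (Inc_divides c) x" if "range x \<subseteq> indexed_monomials c" for x
    using that by (rule Inc_divides_wqo)
  fix L assume "L \<in> {leading_pairs r J | r. term_order c r \<and> Inc_compatible r}"
  then obtain r where L: "L = leading_pairs r J" and r: "term_order c r" "Inc_compatible r"
    by blast
  show "L \<subseteq> indexed_monomials c"
    unfolding L leading_pairs_def indexed_monomials_def using lead[OF r(1)] D(1) by fastforce
  show "y \<in> L" if "x \<in> L" "Inc_divides c x y" for x y
    using leading_pairs_upclosed[OF J r] that unfolding L by blast
  fix x assume x: "x \<in> L"
  then obtain n t where nt: "x = (n, t)" "n \<ge> 1"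
    and t: "t \<in> {leading_mon r f | f. f \<in> J n \<and> f \<noteq> 0}"
    unfolding L leading_pairs_def by blast
  have smult: "Poly_Mapping.single 0 a * f \<in> J n" if "f \<in> J n" for a f
    by (rule D(4)[OF nt(2) that]) (auto simp: monomials_upto_def)
  obtain f where f: "f \<in> J n"
    "Poly_Mapping.keys f \<inter> {leading_mon r f | f. f \<in> J n \<and> f \<noteq> 0} = {t}"
    using exists_reduced[OF r(1) nt(2) D(1)[OF nt(2)] D(2)[OF nt(2)] D(3)[OF nt(2)] smult t] by blast
  then have "f \<noteq> 0" by auto
  show "\<exists>K. finite K \<and> K \<inter> L = {x} \<and>
      (\<forall>L'\<in>{leading_pairs r J | r. term_order c r \<and> Inc_compatible r}. K \<inter> L' \<noteq> {})"
  \<comment> \<open>The reduced \<open>f\<close> separates: its support meets \<open>L\<close> in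
    \<open>t\<close> alone, and any other term order selects its leading monomial from the same
    support.\<close>
  proof (intro exI[of _ "{n} \<times> Poly_Mapping.keys f"] conjI ballI)
    show "({n} \<times> Poly_Mapping.keys f) \<inter> L = {x}"
      using f(2) nt unfolding L leading_pairs_def by blast
    fix L' assume "L' \<in> {leading_pairs r J | r. term_order c r \<and> Inc_compatible r}"
    then obtain r' where L': "L' = leading_pairs r' J" "term_order c r'" by blast
    have "(n, leading_mon r' f) \<in> L'"
      unfolding L' leading_pairs_def using f(1) nt(2) \<open>f \<noteq> 0\<close> by blast
    then show "({n} \<times> Poly_Mapping.keys f) \<inter> L' \<noteq> {}"
      using lead[OF L'(2) nt(2) f(1) \<open>f \<noteq> 0\<close>] by blast
  qed simp
qed

theorem mainTheorem2:
  fixes c :: nat and J :: "nat \<Rightarrow> 'k::field mpoly set"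
  assumes "c \<ge> 1" and "Inc_invariant_chain c J"
  shows "finite {initial_chain c r J | r. term_order c r \<and> Inc_compatible r}"
proof -
  \<comment> \<open>\<open>F\<close> recovers the chain from the pairs, so the set of chains is the
    image of a finite set.\<close>
  define F :: "(nat \<times> mon) set \<Rightarrow> nat \<Rightarrow> 'k mpoly set" where
    "F L = (\<lambda>n\<in>{1..}. Idl\<^bsub>poly_ring_upto c n\<^esub> ((\<lambda>t. Poly_Mapping.single t 1) ` (L `` {n})))" for L
  have "initial_chain c r J = F (leading_pairs r J)" for r
    unfolding F_def by (rule initial_chain_eq)
  then have "{initial_chain c r J | r. term_order c r \<and> Inc_compatible r} =
    F ` {leading_pairs r J | r. term_order c r \<and> Inc_compatible r}"
    by auto
  then show ?thesis
    using finite_imageI[OF finite_leading_pairs[OF assms(2)]] by (rule ssubst)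
qed

end
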